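(* Let $G=(V,E)$ be a finite connected graph with at least one edge and with girth at least $6$, and let $\bar\kappa=2\left(\frac{|V|}{|E|}-1\right)$. There exist positive weights on $E$ satisfying $\kappa_e=\bar\kappa$ for every $e\in E$ if and only if $$\max_{\emptyset\neq\Omega\subsetneqq V}\frac{|E(\Omega)|}{|\Omega|}<\frac{|E|}{|V|}.$$
   Context: Graphs are finite, connected, undirected and simple. The girth is the length of a shortest cycle; girth at least $6$ means there are no cycles of length $3$, $4$ or $5$ (trees are included). For $\Omega\subseteq V$, $E(\Omega)$ is the set of edges of the subgraph induced by $\Omega$, and $|\cdot|$ denotes cardinality. Positive weights are functions $\omega:E\to(0,\infty)$; $\omega_{xy}=\omega_{yx}$ is the weight of edge $(x,y)$. Write $y\sim x$ if $(x,y)\in E$, and $m(x)=\sum_{y\sim x}\omega_{xy}$. The distance $d(u,v)$ is the combinatorial one (number of edges of a shortest path). Lin-Lu-Yau curvature: for $x\in V$ and $\alpha\in(0,1)$ let $m_x^\alpha$ be the probability measure with $m_x^\alpha(x)=\alpha$, $m_x^\alpha(y)=(1-\alpha)\omega_{xy}/m(x)$ for $y\sim x$, and $0$ otherwise. For an edge $e=(x,y)$, $\kappa_e=\lim_{\alpha\to1^-}\frac{1}{1-\alpha}\left(1-W(m_x^\alpha,m_y^\alpha)\right)$, where $W$ is the $1$-Wasserstein distance with respect to $d$. On a graph with girth at least $6$ one has, for every edge $e=(x,y)$, $\kappa_e=2\omega_e\left(\frac1{m(x)}+\frac1{m(y)}\right)-2$. The number $\bar\kappa$ is the average curvature $\frac1{|E|}\sum_{e\in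 E}\kappa_e$. *)

theory Defs
  imports Complex_Main "HOL-Library.Extended_Nat"
begin

section \<open>Finite connected simple graphs\<close>

text \<open>A graph is given by its vertex set \<open>V\<close> and its set \<open>E\<close> of edges, an edge being the
  two-element set of its endpoints.\<close>

definition simple_graph :: "'a set \<Rightarrow> 'a set set \<Rightarrow> bool" where
  "simple_graph V E \<longleftrightarrow> finite V \<and> (\<forall>e\<in>E. e \<subseteq> V \<and> card e = 2)"

definition adj :: "'a set set \<Rightarrow> 'a \<Rightarrow> 'a \<Rightarrow> bool" where
  "adj E x y \<longleftrightarrow> {x, y} \<in> E"

text \<open>Paths and cycles are lists of distinct vertices. A path has \<open>length p - 1\<close> edges;
  the closing edge of a cycle joins \<open>last c\<close> to \<open>hd c\<close>, so a cycle has \<open>length c\<close> edges.\<close>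

definition path_between :: "'a set \<Rightarrow> 'a set set \<Rightarrow> 'a \<Rightarrow> 'a list \<Rightarrow> 'a \<Rightarrow> bool" where
  "path_between V E u p v \<longleftrightarrow>
     p \<noteq> [] \<and> hd p = u \<and> last p = v \<and> set p \<subseteq> V \<and> distinct p \<and> successively (adj E) p"

definition connected_graph :: "'a set \<Rightarrow> 'a set set \<Rightarrow> bool" where
  "connected_graph V E \<longleftrightarrow> V \<noteq> {} \<and> (\<forall>u\<in>V. \<forall>v\<in>V. \<exists>p. path_between V E u p v)"

definition graph_dist :: "'a set \<Rightarrow> 'a set set \<Rightarrow> 'a \<Rightarrow> 'a \<Rightarrow> nat" where
  "graph_dist V E u v = (LEAST n. \<exists>p. path_between V E u p v \<and> length p = Suc n)"

definition is_cycle :: "'a set set \<Rightarrow> 'a list \<Rightarrow> bool" where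
  "is_cycle E c \<longleftrightarrow> length c \<ge> 3 \<and> distinct c \<and> successively (adj E) c \<and> adj E (last c) (hd c)"

text \<open>The girth of a tree is \<open>\<infinity>\<close>, the infimum of the empty set in \<^typ>\<open>enat\<close>.\<close>

definition girth :: "'a set set \<Rightarrow> enat" where
  "girth E = (INF c\<in>{c. is_cycle E c}. enat (length c))"

definition induced_edges :: "'a set set \<Rightarrow> 'a set \<Rightarrow> 'a set set" where
  "induced_edges E \<Omega> = {e \<in> E. e \<subseteq> \<Omega>}"

section \<open>Lin-Lu-Yau curvature\<close>

text \<open>Weights are functions on unordered edges, so that their symmetry is built in; only the
  values on \<open>E\<close> matter.\<close>

definition positive_weights :: "'a set set \<Rightarrow> ('a set \<Rightarrow> real) \<Rightarrow> bool" where
  "positive_weights E \<omega> \<longleftrightarrow> (\<forall>e\<in>E. \<omega> e > 0)"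

definition weighted_degree :: "'a set \<Rightarrow> 'a set set \<Rightarrow> ('a set \<Rightarrow> real) \<Rightarrow> 'a \<Rightarrow> real" where
  "weighted_degree V E \<omega> x = (\<Sum>y\<in>{y\<in>V. adj E x y}. \<omega> {x, y})"

definition lazy_measure ::
    "'a set \<Rightarrow> 'a set set \<Rightarrow> ('a set \<Rightarrow> real) \<Rightarrow> real \<Rightarrow> 'a \<Rightarrow> 'a \<Rightarrow> real" where
  "lazy_measure V E \<omega> \<alpha> x z =
     (if z = x then \<alpha>
      else if adj E x z then (1 - \<alpha>) * \<omega> {x, z} / weighted_degree V E \<omega> x
      else 0)"

text \<open>Probability measures on the finite set \<open>V\<close> are represented by their mass functions.\<close>

definition coupling :: "'a set \<Rightarrow> ('a \<Rightarrow> real) \<Rightarrow> ('a \<Rightarrow> real) \<Rightarrow> ('a \<Rightarrow> 'a \<Rightarrow> real) \<Rightarrow> bool" where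
  "coupling V \<mu> \<nu> \<pi> \<longleftrightarrow>
     (\<forall>u\<in>V. \<forall>v\<in>V. \<pi> u v \<ge> 0) \<and>
     (\<forall>u\<in>V. (\<Sum>v\<in>V. \<pi> u v) = \<mu> u) \<and>
     (\<forall>v\<in>V. (\<Sum>u\<in>V. \<pi> u v) = \<nu> v)"

definition wasserstein :: "'a set \<Rightarrow> 'a set set \<Rightarrow> ('a \<Rightarrow> real) \<Rightarrow> ('a \<Rightarrow> real) \<Rightarrow> real" where
  "wasserstein V E \<mu> \<nu> =
     (INF \<pi>\<in>{\<pi>. coupling V \<mu> \<nu> \<pi>}. \<Sum>u\<in>V. \<Sum>v\<in>V. real (graph_dist V E u v) * \<pi> u v)"

definition lly_curvature ::
    "'a set \<Rightarrow> 'a set set \<Rightarrow> ('a set \<Rightarrow> real) \<Rightarrow> 'a \<Rightarrow> 'a \<Rightarrow> real" where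
  "lly_curvature V E \<omega> x y =
     Lim (at_left 1) (\<lambda>\<alpha>. 1 / (1 - \<alpha>) *
       (1 - wasserstein V E (lazy_measure V E \<omega> \<alpha> x) (lazy_measure V E \<omega> \<alpha> y)))"

end

theory Submission imports Defs "HOL-Analysis.Function_Topology" begin

text \<open>The theorem rests on three facts.

  \<^bold>\<open>Curvature.\<close> On a graph of girth at least six, the curvature of an edge \<open>xy\<close> is
  \<open>2 \<omega>\<^sub>x\<^sub>y (1 / m x + 1 / m y) - 2\<close>. Around the edge, distances are those of a tree: the
  path from a neighbour of \<open>x\<close> along \<open>xy\<close> to a neighbour of \<open>y\<close> is a geodesic. Hence a potential
  falling from 3 to 0 across the edge measures all relevant distances, and both this potential and a
  coupling that never moves mass backwards, from \<open>y\<close> to \<open>x\<close>, are optimal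
  (\<open>lly_curvature_eq\<close>). Constant curvature therefore means that
  \<open>\<omega>\<^sub>x\<^sub>y (1 / m x + 1 / m y) = \<theta>\<close> on all edges, where \<open>\<theta> = |V| / |E|\<close>; such weights are called
  balanced below.

  \<^bold>\<open>Necessity.\<close> Sum the balance equation over the edges inside \<open>\<Omega>\<close> and collect the terms at
  each vertex. A vertex \<open>z\<close> contributes the fraction of \<open>m z\<close> carried by edges inside \<open>\<Omega>\<close>, at
  most 1, and less than 1 at some vertex because an edge leaves \<open>\<Omega>\<close>. So
  \<open>\<theta> |E(\<Omega>)| < |\<Omega>|\<close> (\<open>balanced_imp_sparse\<close>).

  \<^bold>\<open>Sufficiency.\<close> Writing \<open>1 / m x = exp (s x)\<close>, the balance equation forces
  \<open>\<omega>\<^sub>x\<^sub>y = \<theta> / (exp (s x) + exp (s y))\<close>, and the requirement that these weights have the prescribed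
  degrees says exactly that \<open>s\<close> is a critical point of
  \<open>\<theta> \<Sum>\<^sub>x\<^sub>y ln (exp (s x) + exp (s y)) - \<Sum>\<^sub>x s x\<close>. This energy does not change when a constant is
  added to \<open>s\<close>. It is bounded below by the piecewise linear function with
  \<open>max (s x) (s y)\<close> in place of the logarithm, and raising the lowest level set \<open>B\<close> of \<open>s\<close>
  by \<open>d\<close> lowers that function by \<open>d (|B| - \<theta> |E(B)|)\<close>. The density condition makes this
  decrease at least a fixed positive multiple of \<open>d\<close>, so the energy grows at least linearly with
  the oscillation of \<open>s\<close> (\<open>max_energy_ge_oscillation\<close>), a minimum exists, and it yields the weights
  (\<open>sparse_imp_balanced\<close>).\<close>

section \<open>Optimal transport on a finite set\<close>

lemma coupling_nonzero:
  assumes "finite V" "coupling V \<mu> \<nu> \<pi>" "u \<in> V" "v \<in> V" "\<pi> u v \<noteq> 0"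
  shows "\<mu> u \<noteq> 0" "\<nu> v \<noteq> 0"
proof -
  have nonneg: "\<And>a b. a \<in> V \<Longrightarrow> b \<in> V \<Longrightarrow> \<pi> a b \<ge> 0"
    and marg: "(\<Sum>b\<in>V. \<pi> u b) = \<mu> u" "(\<Sum>a\<in>V. \<pi> a v) = \<nu> v"
    using assms by (auto simp: coupling_def)
  have "\<pi> u v > 0" using nonneg assms by (simp add: less_le)
  moreover have "\<pi> u v \<le> (\<Sum>b\<in>V. \<pi> u b)" "\<pi> u v \<le> (\<Sum>a\<in>V. \<pi> a v)"
    using assms nonneg by (auto intro: member_le_sum[of v V "\<pi> u"]
        member_le_sum[of u V "\<lambda>a. \<pi> a v"])
  ultimately show "\<mu> u \<noteq> 0" "\<nu> v \<noteq> 0" using marg by linarith+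
qed

lemma coupling_potential_difference:
  fixes f :: "'a \<Rightarrow> real"
  assumes "coupling V \<mu> \<nu> \<pi>"
  shows "(\<Sum>u\<in>V. \<Sum>v\<in>V. (f u - f v) * \<pi> u v) = (\<Sum>u\<in>V. \<mu> u * f u) - (\<Sum>v\<in>V. \<nu> v * f v)"
proof -
  have "(\<Sum>u\<in>V. \<Sum>v\<in>V. (f u - f v) * \<pi> u v)
      = (\<Sum>u\<in>V. \<Sum>v\<in>V. \<pi> u v * f u) - (\<Sum>u\<in>V. \<Sum>v\<in>V. \<pi> u v * f v)"
    by (simp add: left_diff_distrib mult.commute[of "\<pi> _ _"] flip: sum_subtractf)
  also have "(\<Sum>u\<in>V. \<Sum>v\<in>V. \<pi> u v * f v) = (\<Sum>v\<in>V. \<Sum>u\<in>V. \<pi> u v * f v)"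
    by (rule sum.swap)
  finally show ?thesis
    using assms by (simp add: coupling_def flip: sum_distrib_right)
qed

text \<open>Complementary slackness in Kantorovich duality: a potential that is 1-Lipschitz between the
  two supports bounds the cost of every coupling from below, and a coupling that only moves mass along
  pairs where the Lipschitz bound is attained reaches this bound.\<close>

lemma wasserstein_eq_potential_difference:
  fixes f :: "'a \<Rightarrow> real"
  assumes "finite V" and \<pi>: "coupling V \<mu> \<nu> \<pi>"
    and le: "\<And>u v. u \<in> V \<Longrightarrow> v \<in> V \<Longrightarrow> \<mu> u \<noteq> 0 \<Longrightarrow> \<nu> v \<noteq> 0 \<Longrightarrow>
               f u - f v \<le> real (graph_dist V E u v)"
    and eq: "\<And>u v. u \<in> V \<Longrightarrow> v \<in> V \<Longrightarrow> \<pi> u v \<noteq> 0 \<Longrightarrow>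
               real (graph_dist V E u v) = f u - f v"
  shows "wasserstein V E \<mu> \<nu> = (\<Sum>u\<in>V. \<mu> u * f u) - (\<Sum>v\<in>V. \<nu> v * f v)"
  unfolding wasserstein_def
proof (rule cInf_eq_minimum)
  have "(\<Sum>u\<in>V. \<Sum>v\<in>V. real (graph_dist V E u v) * \<pi> u v)
      = (\<Sum>u\<in>V. \<Sum>v\<in>V. (f u - f v) * \<pi> u v)"
    using eq by (intro sum.cong refl) (metis mult_zero_right)
  then show "(\<Sum>u\<in>V. \<mu> u * f u) - (\<Sum>v\<in>V. \<nu> v * f v)
      \<in> (\<lambda>\<pi>. \<Sum>u\<in>V. \<Sum>v\<in>V. real (graph_dist V E u v) * \<pi> u v) ` {\<pi>. coupling V \<mu> \<nu> \<pi>}"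
    using \<pi> coupling_potential_difference[OF \<pi>, of f] by (intro image_eqI[of _ _ \<pi>]) auto
next
  fix w
  assume "w \<in> (\<lambda>\<pi>. \<Sum>u\<in>V. \<Sum>v\<in>V. real (graph_dist V E u v) * \<pi> u v) ` {\<pi>. coupling V \<mu> \<nu> \<pi>}"
  then obtain \<rho> where \<rho>: "coupling V \<mu> \<nu> \<rho>"
    and w: "w = (\<Sum>u\<in>V. \<Sum>v\<in>V. real (graph_dist V E u v) * \<rho> u v)" by auto
  have "(f u - f v) * \<rho> u v \<le> real (graph_dist V E u v) * \<rho> u v" if "u \<in> V" "v \<in> V" for u v
  proof (cases "\<rho> u v = 0")
    case False
    then have "f u - f v \<le> real (graph_dist V E u v)"
      using le that coupling_nonzero[OF \<open>finite V\<close> \<rho> that] by blast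
    moreover have "\<rho> u v \<ge> 0" using \<rho> that by (simp add: coupling_def)
    ultimately show ?thesis by (rule mult_right_mono)
  qed simp
  then have "(\<Sum>u\<in>V. \<Sum>v\<in>V. (f u - f v) * \<rho> u v) \<le> w"
    unfolding w by (intro sum_mono)
  then show "(\<Sum>u\<in>V. \<mu> u * f u) - (\<Sum>v\<in>V. \<nu> v * f v) \<le> w"
    using coupling_potential_difference[OF \<rho>, of f] by simp
qed

text \<open>A mass \<open>c z\<close> common to both measures may stay in place while the two remainders, which have
  equal total mass, are coupled independently. Choosing \<open>c z = \<mu> z\<close> or \<open>c z = \<nu> z\<close> forbids all
  movement out of \<open>z\<close> or into \<open>z\<close>.\<close>

lemma coupling_stay_plus_product:
  fixes c \<mu> \<nu> :: "'a \<Rightarrow> real"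
  assumes "finite V" and total: "sum \<mu> V = T" "sum \<nu> V = T" and less: "sum c V < T"
    and c: "\<And>z. z \<in> V \<Longrightarrow> 0 \<le> c z" "\<And>z. z \<in> V \<Longrightarrow> c z \<le> \<mu> z" "\<And>z. z \<in> V \<Longrightarrow> c z \<le> \<nu> z"
  shows "coupling V \<mu> \<nu>
    (\<lambda>u v. (if u = v then c u else 0) + (\<mu> u - c u) * (\<nu> v - c v) / (T - sum c V))"
proof -
  have "(\<Sum>v\<in>V. (\<mu> u - c u) * (\<nu> v - c v) / (T - sum c V)) = \<mu> u - c u" for u
  proof -
    have "(\<Sum>v\<in>V. (\<mu> u - c u) * (\<nu> v - c v) / (T - sum c V))
        = (\<mu> u - c u) * (\<Sum>v\<in>V. \<nu> v - c v) / (T - sum c V)"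
      by (simp add: sum_distrib_left sum_divide_distrib)
    then show ?thesis using total less by (simp add: sum_subtractf)
  qed
  moreover have "(\<Sum>u\<in>V. (\<mu> u - c u) * (\<nu> v - c v) / (T - sum c V)) = \<nu> v - c v" for v
  proof -
    have "(\<Sum>u\<in>V. (\<mu> u - c u) * (\<nu> v - c v) / (T - sum c V))
        = (\<Sum>u\<in>V. \<mu> u - c u) * (\<nu> v - c v) / (T - sum c V)"
      by (simp add: sum_distrib_right sum_divide_distrib)
    then show ?thesis using total less by (simp add: sum_subtractf)
  qed
  ultimately show ?thesis
    using assms by (simp add: coupling_def sum.distrib sum.delta sum.delta')
qed

section \<open>Finite connected graphs\<close>

locale finite_connected_graph =
  fixes V :: "'a set" and E :: "'a set set"
  assumes simple: "simple_graph V E"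
    and connected: "connected_graph V E"
    and has_edge: "E \<noteq> {}"
begin

lemma finite_V: "finite V"
  using simple by (simp add: simple_graph_def)

lemma finite_E: "finite E"
proof (rule finite_subset)
  show "E \<subseteq> Pow V" using simple by (auto simp: simple_graph_def)
qed (simp add: finite_V)

lemma edge_subset: "e \<in> E \<Longrightarrow> e \<subseteq> V"
  using simple by (simp add: simple_graph_def)

lemma edge_card: "e \<in> E \<Longrightarrow> card e = 2"
  using simple by (simp add: simple_graph_def)

lemma edge_finite: "e \<in> E \<Longrightarrow> finite e"
  using edge_card by (metis card.infinite zero_neq_numeral)

lemma edge_nonempty: "e \<in> E \<Longrightarrow> e \<noteq> {}"
  using edge_card by fastforce

lemma adj_sym: "adj E x y \<Longrightarrow> adj E y x"
  by (simp add: adj_def insert_commute)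

lemma adj_in_V: "adj E x y \<Longrightarrow> x \<in> V \<and> y \<in> V"
  using edge_subset by (auto simp: adj_def)

lemma adj_distinct: "adj E x y \<Longrightarrow> x \<noteq> y"
  using edge_card by (fastforce simp: adj_def)

lemma V_nonempty: "V \<noteq> {}"
  using connected by (simp add: connected_graph_def)

lemma card_V_pos: "card V > 0"
  using V_nonempty finite_V by (simp add: card_gt_0_iff)

lemma card_E_pos: "card E > 0"
  using has_edge finite_E by (simp add: card_gt_0_iff)

text \<open>Passes between sums over neighbours of a vertex and sums over its incident edges: both
  descriptions of the weighted degree are needed, the first for measures on vertices and the second
  for counting edges.\<close>

lemma neighbour_sum:
  fixes g :: "'a set \<Rightarrow> real"
  shows "(\<Sum>y\<in>{y \<in> V. adj E x y}. g {x, y}) = (\<Sum>e\<in>{e \<in> E. x \<in> e}. g e)"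
proof (rule sum.reindex_bij_betw)
  show "bij_betw (\<lambda>y. {x, y}) {y \<in> V. adj E x y} {e \<in> E. x \<in> e}"
  proof (rule bij_betwI')
    fix y z assume "y \<in> {y \<in> V. adj E x y}" "z \<in> {y \<in> V. adj E x y}"
    then show "({x, y} = {x, z}) = (y = z)" by (auto simp: doubleton_eq_iff)
  next
    fix e assume e: "e \<in> {e \<in> E. x \<in> e}"
    then have "card e = 2" using edge_card by simp
    then obtain y where "e = {x, y}"
      using e by (auto simp: card_2_iff)
    with e show "\<exists>y\<in>{y \<in> V. adj E x y}. e = {x, y}"
      using edge_subset by (auto simp: adj_def)
  qed (auto simp: adj_def)
qed

lemma weighted_degree_incident:
  "weighted_degree V E \<omega> x = (\<Sum>e\<in>{e \<in> E. x \<in> e}. \<omega> e)"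
  unfolding weighted_degree_def by (rule neighbour_sum)

lemma weighted_degree_pos:
  assumes "positive_weights E \<omega>" "adj E x y"
  shows "weighted_degree V E \<omega> x > 0"
  unfolding weighted_degree_incident
proof (rule sum_pos)
  show "{e \<in> E. x \<in> e} \<noteq> {}" using assms(2) by (auto simp: adj_def)
qed (use assms(1) finite_E in \<open>auto simp: positive_weights_def\<close>)


lemma lazy_measure_expectation:
  assumes "x \<in> V"
  shows "(\<Sum>z\<in>V. lazy_measure V E \<omega> \<alpha> x z * g z) =
    \<alpha> * g x + (1 - \<alpha>) / weighted_degree V E \<omega> x * (\<Sum>z\<in>{z \<in> V. adj E x z}. \<omega> {x, z} * g z)"
proof -
  have "lazy_measure V E \<omega> \<alpha> x z * g z = (if z = x then \<alpha> * g z else 0) +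
      (if adj E x z then (1 - \<alpha>) / weighted_degree V E \<omega> x * (\<omega> {x, z} * g z) else 0)" for z
    using adj_distinct by (auto simp: lazy_measure_def)
  then show ?thesis
    using assms finite_V
    by (simp add: sum.distrib sum.delta sum_distrib_left flip: sum.inter_filter)
qed

lemma lazy_measure_total:
  assumes "positive_weights E \<omega>" "adj E x y"
  shows "sum (lazy_measure V E \<omega> \<alpha> x) V = 1"
  using lazy_measure_expectation[of x \<omega> \<alpha> "\<lambda>_. 1"] weighted_degree_pos[OF assms] adj_in_V[OF assms(2)]
  by (simp flip: weighted_degree_def)

lemma lazy_measure_nonneg:
  assumes "positive_weights E \<omega>" "adj E x y" "0 \<le> \<alpha>" "\<alpha> \<le> 1"
  shows "lazy_measure V E \<omega> \<alpha> x z \<ge> 0"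
  using weighted_degree_pos[OF assms(1,2)] assms
  by (auto simp: lazy_measure_def positive_weights_def adj_def less_imp_le)

lemma lazy_measure_neighbour_le:
  assumes pos: "positive_weights E \<omega>" and xy: "adj E x y" and "\<alpha> \<le> 1"
  shows "lazy_measure V E \<omega> \<alpha> x y \<le> 1 - \<alpha>"
proof -
  have "\<omega> {x, y} \<le> weighted_degree V E \<omega> x"
    unfolding weighted_degree_incident
  proof (rule member_le_sum)
    show "{x, y} \<in> {e \<in> E. x \<in> e}" using xy by (simp add: adj_def)
  qed (use pos finite_E in \<open>auto simp: positive_weights_def less_imp_le\<close>)
  then have "(1 - \<alpha>) * \<omega> {x, y} \<le> (1 - \<alpha>) * weighted_degree V E \<omega> x"
    using assms by (intro mult_left_mono) auto
  then show ?thesis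
    using xy adj_distinct[OF xy] weighted_degree_pos[OF pos xy]
    by (simp add: lazy_measure_def pos_divide_le_eq)
qed

lemma graph_dist_le:
  assumes "path_between V E u p v"
  shows "graph_dist V E u v \<le> length p - 1"
  unfolding graph_dist_def
proof (rule Least_le)
  have "p \<noteq> []" using assms by (simp add: path_between_def)
  then show "\<exists>q. path_between V E u q v \<and> length q = Suc (length p - 1)"
    using assms by (intro exI[of _ p]) simp
qed

lemma graph_dist_witness:
  assumes "u \<in> V" "v \<in> V"
  obtains p where "path_between V E u p v" "length p = Suc (graph_dist V E u v)"
proof -
  obtain p where p: "path_between V E u p v"
    using connected assms unfolding connected_graph_def by blast
  then have "p \<noteq> []" by (simp add: path_between_def)
  then have "length p = Suc (length p - 1)" by simp
  then have "\<exists>n p. path_between V E u p v \<and> length p = Suc n" using p by blast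
  then have "\<exists>p. path_between V E u p v \<and> length p = Suc (graph_dist V E u v)"
    unfolding graph_dist_def by (rule LeastI_ex)
  then show thesis using that by blast
qed

lemma graph_dist_eq_0: "u \<in> V \<Longrightarrow> graph_dist V E u u = 0"
  using graph_dist_le[of u "[u]" u] by (simp add: path_between_def)

lemma graph_dist_not_0:
  assumes "u \<in> V" "v \<in> V" "u \<noteq> v"
  shows "graph_dist V E u v \<noteq> 0"
proof
  assume "graph_dist V E u v = 0"
  then obtain p where "path_between V E u p v" "length p = 1"
    using graph_dist_witness[OF assms(1,2)] by auto
  then show False using assms(3) by (auto simp: length_Suc_conv path_between_def)
qed

lemma graph_dist_eq_1D:
  assumes "u \<in> V" "v \<in> V" "graph_dist V E u v = 1"
  shows "adj E u v"
proof -
  obtain p where p: "path_between V E u p v" "length p = Suc (Suc 0)"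
    using graph_dist_witness[OF assms(1,2)] assms(3) by auto
  then obtain a b where "p = [a, b]" by (auto simp only: length_Suc_conv length_0_conv)
  with p(1) have "a = u" "b = v" "adj E a b" by (auto simp: path_between_def)
  then show ?thesis by simp
qed

lemma graph_dist_eq_2D:
  assumes "u \<in> V" "v \<in> V" "graph_dist V E u v = 2"
  obtains w where "adj E u w" "adj E w v"
proof -
  obtain p where p: "path_between V E u p v" "length p = Suc (Suc (Suc 0))"
    using graph_dist_witness[OF assms(1,2)] unfolding assms(3) numeral_2_eq_2 by blast
  then obtain a b c where "p = [a, b, c]" by (auto simp only: length_Suc_conv length_0_conv)
  with p(1) have "a = u" "c = v" "adj E a b" "adj E b c" by (auto simp: path_between_def)
  then show thesis using that by simp
qed

lemma graph_dist_adj: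
  assumes "adj E u v"
  shows "graph_dist V E u v = 1"
proof -
  have "graph_dist V E u v \<le> 1"
    using graph_dist_le[of u "[u, v]" v] assms adj_in_V adj_distinct
    by (fastforce simp: path_between_def)
  moreover have "graph_dist V E u v \<noteq> 0"
    using graph_dist_not_0 assms adj_in_V adj_distinct by blast
  ultimately show ?thesis by linarith
qed

end

section \<open>Distances near an edge in a graph of girth at least six\<close>

locale girth_six_graph = finite_connected_graph +
  assumes girth: "girth E \<ge> 6"
begin

lemma cycle_length:
  assumes "is_cycle E c"
  shows "length c \<ge> 6"
proof -
  have "girth E \<le> enat (length c)"
    unfolding girth_def using assms by (intro INF_lower) simp
  then have "(6::enat) \<le> enat (length c)" using girth order_trans by blast
  then show ?thesis by (simp add: numeral_eq_enat)
qed

lemma no_triangle: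
  assumes "adj E a b" "adj E b c" "adj E c a"
  shows False
proof -
  have "is_cycle E [a, b, c]"
    using assms adj_distinct[OF assms(1)] adj_distinct[OF assms(2)] adj_distinct[OF assms(3)]
    by (auto simp: is_cycle_def)
  then show False using cycle_length by fastforce
qed

lemma no_quadrilateral:
  assumes "adj E a b" "adj E b c" "adj E c d" "adj E d a" "a \<noteq> c" "b \<noteq> d"
  shows False
proof -
  have "is_cycle E [a, b, c, d]"
    using assms adj_distinct[OF assms(1)] adj_distinct[OF assms(2)] adj_distinct[OF assms(3)]
      adj_distinct[OF assms(4)]
    by (auto simp: is_cycle_def)
  then show False using cycle_length by fastforce
qed

text \<open>Two vertices of a closed walk of length five can only coincide if the walk contains a
  triangle.\<close>

lemma no_pentagon:
  assumes "adj E a b" "adj E b c" "adj E c d" "adj E d e" "adj E e a"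
  shows False
proof -
  have "a \<noteq> c" "b \<noteq> d" "c \<noteq> e" "a \<noteq> d" "b \<noteq> e"
    using assms no_triangle by blast+
  then have "is_cycle E [a, b, c, d, e]"
    using assms adj_distinct[OF assms(1)] adj_distinct[OF assms(2)] adj_distinct[OF assms(3)]
      adj_distinct[OF assms(4)] adj_distinct[OF assms(5)]
    by (auto simp: is_cycle_def)
  then show False using cycle_length by fastforce
qed

lemma graph_dist_two_steps:
  assumes "adj E u w" "adj E w v" "u \<noteq> v"
  shows "graph_dist V E u v = 2"
proof -
  have V: "u \<in> V" "v \<in> V" "w \<in> V" using assms adj_in_V by blast+
  have "graph_dist V E u v \<le> 2"
    using graph_dist_le[of u "[u, w, v]" v] assms V adj_distinct[OF assms(1)]
      adj_distinct[OF assms(2)]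
    by (auto simp: path_between_def)
  moreover have "graph_dist V E u v \<noteq> 0"
    using graph_dist_not_0 V assms(3) by blast
  moreover have "graph_dist V E u v \<noteq> 1"
    using graph_dist_eq_1D[OF V(1,2)] no_triangle assms adj_sym by blast
  ultimately show ?thesis by linarith
qed

text \<open>A walk of three steps without backtracking is a geodesic: a shortcut of length 0, 1 or 2
  would close it to a triangle, a quadrilateral or a pentagon. This is where the full girth hypothesis
  enters.\<close>

lemma graph_dist_three_steps:
  assumes "adj E u w" "adj E w z" "adj E z v" "u \<noteq> z" "w \<noteq> v"
  shows "graph_dist V E u v = 3"
proof -
  have V: "u \<in> V" "v \<in> V" "w \<in> V" "z \<in> V" using assms adj_in_V by blast+
  have "u \<noteq> v" using no_triangle assms by blast
  then have "graph_dist V E u v \<le> 3"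
    using graph_dist_le[of u "[u, w, z, v]" v] assms V adj_distinct[OF assms(1)]
      adj_distinct[OF assms(2)] adj_distinct[OF assms(3)]
    by (auto simp: path_between_def)
  moreover have "graph_dist V E u v \<noteq> 0"
    using graph_dist_not_0 V \<open>u \<noteq> v\<close> by blast
  moreover have "graph_dist V E u v \<noteq> 1"
    using graph_dist_eq_1D[OF V(1,2)] no_quadrilateral assms adj_sym by blast
  moreover have "graph_dist V E u v \<noteq> 2"
  proof
    assume "graph_dist V E u v = 2"
    then obtain t where "adj E u t" "adj E t v"
      using graph_dist_eq_2D[OF V(1,2)] by blast
    then show False using no_pentagon assms adj_sym by blast
  qed
  ultimately show ?thesis by linarith
qed

text \<open>The potential optimal for transport across the edge \<open>xy\<close>: on \<open>x\<close>, \<open>y\<close> and their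
  neighbours it is the height in the double star around the edge, from 3 at the other neighbours of
  \<open>x\<close> to 0 at the other neighbours of \<open>y\<close>.\<close>

definition edge_potential :: "'a \<Rightarrow> 'a \<Rightarrow> 'a \<Rightarrow> real" where
  "edge_potential x y z =
     (if z = x then 2 else if z = y then 1 else if adj E x z then 3 else 0)"

text \<open>From the star of \<open>x\<close> to the star of \<open>y\<close> the potential always descends along a geodesic.
  The single exception is the step back from \<open>y\<close> to \<open>x\<close>, both of which lie in either star.\<close>

lemma graph_dist_edge_potential:
  assumes xy: "adj E x y"
    and u: "u = x \<or> adj E x u" and v: "v = y \<or> adj E y v"
    and not_back: "\<not> (u = y \<and> v = x)"
  shows "real (graph_dist V E u v) = edge_potential x y u - edge_potential x y v"
proof -
  have ne: "x \<noteq> y" and V: "x \<in> V" "y \<in> V" using xy adj_distinct adj_in_V by blast+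
  have v_far: "\<not> adj E x v" if "adj E y v" using no_triangle xy that adj_sym by blast
  have v_ne: "v \<noteq> y" if "adj E y v" using that adj_distinct by blast
  have u_ne: "u \<noteq> x" if "adj E x u" using that adj_distinct by blast
  consider "u = x" "v = x" | "u = y" "v = y" | "u = x" "v = y" | "u = x" "v \<noteq> x" "adj E y v"
    | "u = y" "adj E y v" "v \<noteq> x" | "u \<noteq> y" "adj E x u" "v = x" | "u \<noteq> y" "adj E x u" "v = y"
    | "u \<noteq> y" "adj E x u" "v \<noteq> x" "adj E y v"
    using u v not_back by blast
  then show ?thesis
  proof cases
    case 4
    then show ?thesis using graph_dist_two_steps[OF xy] v_far v_ne ne
      by (auto simp: edge_potential_def)
  next
    case 5
    then show ?thesis using graph_dist_adj[of y v] v_far v_ne ne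
      by (auto simp: edge_potential_def)
  next
    case 6
    then show ?thesis using graph_dist_adj[OF adj_sym, of x u] u_ne ne
      by (auto simp: edge_potential_def)
  next
    case 7
    then show ?thesis using graph_dist_two_steps[of u x y] xy adj_sym u_ne ne
      by (auto simp: edge_potential_def)
  next
    case 8
    then show ?thesis using graph_dist_three_steps[of u x y v] xy adj_sym u_ne v_ne v_far ne
      by (auto simp: edge_potential_def)
  qed (use ne V graph_dist_eq_0 graph_dist_adj[OF xy] in \<open>auto simp: edge_potential_def\<close>)
qed


section \<open>The curvature of an edge\<close>

text \<open>The coupling keeps in place the mass that the first measure has at \<open>y\<close> and the mass that the
  second has at \<open>x\<close>, and couples the rest independently. Then nothing moves from \<open>y\<close> to \<open>x\<close>, so
  the edge potential certifies optimality. Laziness above one half ensures that the central vertices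
  carry enough mass for this.\<close>

lemma wasserstein_lazy_measures:
  assumes pos: "positive_weights E \<omega>" and xy: "adj E x y" and \<alpha>: "1 / 2 < \<alpha>" "\<alpha> < 1"
  shows "wasserstein V E (lazy_measure V E \<omega> \<alpha> x) (lazy_measure V E \<omega> \<alpha> y) =
    1 - (1 - \<alpha>) * (2 * \<omega> {x, y} * (1 / weighted_degree V E \<omega> x + 1 / weighted_degree V E \<omega> y) - 2)"
proof -
  let ?\<mu> = "lazy_measure V E \<omega> \<alpha> x" and ?\<nu> = "lazy_measure V E \<omega> \<alpha> y"
  let ?f = "edge_potential x y"
  note yx = adj_sym[OF xy]
  have ne: "x \<noteq> y" and V: "x \<in> V" "y \<in> V" using xy adj_distinct adj_in_V by blast+
  define mx my where "mx = weighted_degree V E \<omega> x" and "my = weighted_degree V E \<omega> y"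
  have m_pos: "mx > 0" "my > 0"
    unfolding mx_def my_def using weighted_degree_pos pos xy yx by blast+
  \<comment> \<open>Keeping all of the first measure at \<open>y\<close>, and all of the second at \<open>x\<close>, leaves
    remainders that put nothing on the pair \<open>(y, x)\<close>.\<close>
  define c where "c z = (if z = x then ?\<nu> x else if z = y then ?\<mu> y else 0)" for z
  have small: "?\<mu> y \<le> 1 - \<alpha>" "?\<nu> x \<le> 1 - \<alpha>"
    using lazy_measure_neighbour_le[OF pos] xy yx \<alpha> by auto
  have nonneg: "?\<mu> z \<ge> 0" "?\<nu> z \<ge> 0" for z
    using lazy_measure_nonneg[OF pos] xy yx \<alpha> by auto
  have self: "?\<mu> x = \<alpha>" "?\<nu> y = \<alpha>" by (simp_all add: lazy_measure_def)
  have "sum c V = sum c {x, y}"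
    using V finite_V by (intro sum.mono_neutral_right) (auto simp: c_def)
  also have "\<dots> = ?\<nu> x + ?\<mu> y" using ne by (simp add: c_def)
  finally have sum_c: "sum c V < 1" using small \<alpha> by linarith
  define \<pi> where "\<pi> u v = (if u = v then c u else 0) + (?\<mu> u - c u) * (?\<nu> v - c v) / (1 - sum c V)"
    for u v
  have \<pi>: "coupling V ?\<mu> ?\<nu> \<pi>"
    unfolding \<pi>_def
  proof (rule coupling_stay_plus_product)
    show "sum ?\<mu> V = 1" "sum ?\<nu> V = 1"
      using lazy_measure_total[OF pos] xy yx by auto
    show "0 \<le> c z" "c z \<le> ?\<mu> z" "c z \<le> ?\<nu> z" for z
      using nonneg small self \<alpha> unfolding c_def by auto
  qed (use finite_V sum_c in auto)
  have "\<pi> y x = 0" using ne by (simp add: \<pi>_def c_def)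
  have supp: "u = x \<or> adj E x u" if "?\<mu> u \<noteq> 0" for u
    using that by (auto simp: lazy_measure_def split: if_splits)
  have supp': "v = y \<or> adj E y v" if "?\<nu> v \<noteq> 0" for v
    using that by (auto simp: lazy_measure_def split: if_splits)
  have "wasserstein V E ?\<mu> ?\<nu> = (\<Sum>u\<in>V. ?\<mu> u * ?f u) - (\<Sum>v\<in>V. ?\<nu> v * ?f v)"
  proof (rule wasserstein_eq_potential_difference[OF finite_V \<pi>])
    fix u v assume uv: "u \<in> V" "v \<in> V" "?\<mu> u \<noteq> 0" "?\<nu> v \<noteq> 0"
    \<comment> \<open>On the exceptional pair the potential rises, so the inequality is still true.\<close>
    show "?f u - ?f v \<le> real (graph_dist V E u v)"
    proof (cases "u = y \<and> v = x")
      case True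
      then show ?thesis using ne by (simp add: edge_potential_def)
    next
      case False
      then show ?thesis using graph_dist_edge_potential[OF xy] supp supp' uv by simp
    qed
  next
    fix u v assume uv: "u \<in> V" "v \<in> V" "\<pi> u v \<noteq> 0"
    then have "\<not> (u = y \<and> v = x)" using \<open>\<pi> y x = 0\<close> by blast
    then show "real (graph_dist V E u v) = ?f u - ?f v"
      using graph_dist_edge_potential[OF xy supp supp'] coupling_nonzero[OF finite_V \<pi>] uv
      by blast
  qed
  also have "(\<Sum>u\<in>V. ?\<mu> u * ?f u) = \<alpha> * 2 + (1 - \<alpha>) / mx * (3 * mx - 2 * \<omega> {x, y})"
  proof -
    have "(\<Sum>z\<in>{z \<in> V. adj E x z}. \<omega> {x, z} * ?f z)
        = (\<Sum>z\<in>{z \<in> V. adj E x z}. 3 * \<omega> {x, z} - (if z = y then 2 * \<omega> {x, z} else 0))"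
      using adj_distinct ne by (intro sum.cong) (auto simp: edge_potential_def)
    also have "\<dots> = 3 * mx - 2 * \<omega> {x, y}"
      using finite_V V xy
      by (simp add: sum_subtractf sum.delta mx_def weighted_degree_def flip: sum_distrib_left)
    finally show ?thesis
      unfolding lazy_measure_expectation[OF V(1)] by (simp add: mx_def edge_potential_def)
  qed
  also have "(\<Sum>v\<in>V. ?\<nu> v * ?f v) = \<alpha> * 1 + (1 - \<alpha>) / my * (2 * \<omega> {x, y})"
  proof -
    have "\<not> adj E x z" if "adj E y z" for z using no_triangle xy that adj_sym by blast
    then have "(\<Sum>z\<in>{z \<in> V. adj E y z}. \<omega> {y, z} * ?f z)
        = (\<Sum>z\<in>{z \<in> V. adj E y z}. if z = x then 2 * \<omega> {y, z} else 0)"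
      using adj_distinct ne by (intro sum.cong) (auto simp: edge_potential_def)
    also have "\<dots> = 2 * \<omega> {x, y}"
      using finite_V V yx by (simp add: sum.delta insert_commute)
    finally show ?thesis
      unfolding lazy_measure_expectation[OF V(2)] using ne by (simp add: my_def edge_potential_def)
  qed
  finally show ?thesis
    using m_pos by (simp add: field_simps flip: mx_def my_def)
qed

lemma lly_curvature_eq:
  assumes pos: "positive_weights E \<omega>" and xy: "adj E x y"
  shows "lly_curvature V E \<omega> x y =
    2 * \<omega> {x, y} * (1 / weighted_degree V E \<omega> x + 1 / weighted_degree V E \<omega> y) - 2"
    (is "_ = ?\<kappa>")
  unfolding lly_curvature_def
proof (rule tendsto_Lim)
  let ?W = "\<lambda>\<alpha>. wasserstein V E (lazy_measure V E \<omega> \<alpha> x) (lazy_measure V E \<omega> \<alpha> y)"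
  have "eventually (\<lambda>\<alpha>::real. \<alpha> \<in> {1/2<..<1}) (at_left 1)"
    by (rule eventually_at_left_real) simp
  then have "eventually (\<lambda>\<alpha>. 1 / (1 - \<alpha>) * (1 - ?W \<alpha>) = ?\<kappa>) (at_left 1)"
    by eventually_elim (simp add: wasserstein_lazy_measures[OF pos xy])
  then show "((\<lambda>\<alpha>. 1 / (1 - \<alpha>) * (1 - ?W \<alpha>)) \<longlongrightarrow> ?\<kappa>) (at_left 1)"
    by (rule tendsto_eventually)
qed simp

end


section \<open>Balanced weights force the density condition\<close>

context finite_connected_graph
begin

definition balanced :: "real \<Rightarrow> ('a set \<Rightarrow> real) \<Rightarrow> bool" where
  "balanced \<theta> \<omega> \<longleftrightarrow> (\<forall>x y. adj E x y \<longrightarrow>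
     \<omega> {x, y} * (1 / weighted_degree V E \<omega> x + 1 / weighted_degree V E \<omega> y) = \<theta>)"

lemma boundary_edge:
  assumes "\<Omega> \<noteq> {}" "\<Omega> \<subset> V"
  obtains a b where "a \<in> \<Omega>" "b \<notin> \<Omega>" "adj E a b"
proof -
  obtain u v where uv: "u \<in> \<Omega>" "v \<in> V" "v \<notin> \<Omega>" using assms by blast
  then obtain p where "path_between V E u p v"
    using connected assms unfolding connected_graph_def by blast
  then have "p \<noteq> []" "hd p \<in> \<Omega>" "last p \<notin> \<Omega>" "successively (adj E) p"
    using uv by (auto simp: path_between_def)
  then have "\<exists>a b. a \<in> \<Omega> \<and> b \<notin> \<Omega> \<and> adj E a b"
  proof (induction p)
    case (Cons a p)
    then show ?case by (cases "p = []") (auto simp: successively_Cons)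
  qed simp
  then show thesis using that by blast
qed

lemma singleton_psubset: "x \<in> V \<Longrightarrow> {x} \<subset> V"
proof -
  assume "x \<in> V"
  obtain e where e: "e \<in> E" using has_edge by blast
  then have "\<not> e \<subseteq> {x}" using edge_card[OF e] card_mono[of "{x}" e] by auto
  then show ?thesis using edge_subset[OF e] \<open>x \<in> V\<close> by blast
qed

lemma weighted_degree_pos_vertex:
  assumes "positive_weights E \<omega>" "x \<in> V"
  shows "weighted_degree V E \<omega> x > 0"
proof -
  obtain y where "adj E x y"
    using boundary_edge[of "{x}"] singleton_psubset[OF assms(2)] by blast
  then show ?thesis using weighted_degree_pos assms(1) by blast
qed

lemma edge_endpoints:
  assumes "e \<in> E"
  obtains x y where "e = {x, y}" "x \<noteq> y" "adj E x y"
proof -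
  obtain x y where "e = {x, y}" "x \<noteq> y" using edge_card[OF assms] by (auto simp: card_2_iff)
  then show thesis using that assms by (simp add: adj_def)
qed

lemma sum_edges_endpoints:
  fixes h :: "'a set \<Rightarrow> 'a \<Rightarrow> real"
  assumes "A \<subseteq> E" "\<And>e. e \<in> A \<Longrightarrow> e \<subseteq> \<Omega>" "\<Omega> \<subseteq> V"
  shows "(\<Sum>e\<in>A. \<Sum>z\<in>e. h e z) = (\<Sum>z\<in>\<Omega>. \<Sum>e\<in>{e \<in> A. z \<in> e}. h e z)"
proof -
  have "(\<Sum>e\<in>A. \<Sum>z\<in>e. h e z) = (\<Sum>e\<in>A. \<Sum>z\<in>{z \<in> \<Omega>. z \<in> e}. h e z)"
    using assms(2) by (intro sum.cong) auto
  also have "\<dots> = (\<Sum>z\<in>\<Omega>. \<Sum>e\<in>{e \<in> A. z \<in> e}. h e z)"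
    using assms finite_E finite_V by (intro sum.swap_restrict) (auto intro: finite_subset)
  finally show ?thesis .
qed

text \<open>The balance equation says that \<open>\<theta>\<close> is the sum of \<open>\<omega> e / m z\<close> over the endpoints \<open>z\<close> of
  \<open>e\<close>. Summing over the edges in \<open>\<Omega>\<close> and regrouping by vertices compares \<open>\<theta> |E(\<Omega>)|\<close> with
  \<open>|\<Omega>|\<close>, since the terms \<open>\<omega> e / m z\<close> over all edges at \<open>z\<close> add up to 1. The comparison
  is strict because of an edge leaving \<open>\<Omega>\<close>.\<close>

lemma balanced_imp_sparse:
  fixes \<theta> :: real
  assumes pos: "positive_weights E \<omega>" and bal: "balanced \<theta> \<omega>" and \<Omega>: "\<Omega> \<noteq> {}" "\<Omega> \<subset> V"
  shows "\<theta> * card (induced_edges E \<Omega>) < card \<Omega>"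
proof -
  let ?m = "weighted_degree V E \<omega>" and ?A = "induced_edges E \<Omega>"
  have A: "?A \<subseteq> E" by (auto simp: induced_edges_def)
  have m_pos: "?m z > 0" if "z \<in> \<Omega>" for z
    using weighted_degree_pos_vertex[OF pos] that \<Omega> by blast
  have full: "(\<Sum>e\<in>{e \<in> E. z \<in> e}. \<omega> e / ?m z) = 1" if "z \<in> \<Omega>" for z
    using m_pos[OF that] by (simp add: weighted_degree_incident flip: sum_divide_distrib)
  have nonneg: "\<omega> e / ?m z \<ge> 0" if "z \<in> \<Omega>" "e \<in> E" for z e
    using m_pos that pos by (simp add: positive_weights_def less_imp_le)
  have edge: "\<theta> = (\<Sum>z\<in>e. \<omega> e / ?m z)" if "e \<in> E" for e
  proof -
    obtain x y where xy: "e = {x, y}" "x \<noteq> y" "adj E x y" using edge_endpoints \<open>e \<in> E\<close> by blast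
    then have "\<theta> = \<omega> {x, y} * (1 / ?m x + 1 / ?m y)" using bal by (simp add: balanced_def)
    then show ?thesis using xy by (simp add: distrib_left)
  qed
  obtain a b where ab: "a \<in> \<Omega>" "b \<notin> \<Omega>" "adj E a b" using boundary_edge \<Omega> by blast
  have "\<theta> * card ?A = (\<Sum>e\<in>?A. \<Sum>z\<in>e. \<omega> e / ?m z)"
  proof -
    have "(\<Sum>e\<in>?A. \<Sum>z\<in>e. \<omega> e / ?m z) = (\<Sum>e\<in>?A. \<theta>)"
      using A edge by (intro sum.cong refl) (metis subsetD)
    then show ?thesis by simp
  qed
  also have "\<dots> = (\<Sum>z\<in>\<Omega>. \<Sum>e\<in>{e \<in> ?A. z \<in> e}. \<omega> e / ?m z)"
    using A \<Omega> by (intro sum_edges_endpoints) (auto simp: induced_edges_def)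
  also have "\<dots> < (\<Sum>z\<in>\<Omega>. 1)"
  proof (rule sum_strict_mono_ex1)
    show "finite \<Omega>" using \<Omega> finite_V finite_subset by blast
    show "\<forall>z\<in>\<Omega>. (\<Sum>e\<in>{e \<in> ?A. z \<in> e}. \<omega> e / ?m z) \<le> 1"
    proof
      fix z assume z: "z \<in> \<Omega>"
      have "(\<Sum>e\<in>{e \<in> ?A. z \<in> e}. \<omega> e / ?m z) \<le> (\<Sum>e\<in>{e \<in> E. z \<in> e}. \<omega> e / ?m z)"
        using A finite_E nonneg[OF z] by (intro sum_mono2) auto
      then show "(\<Sum>e\<in>{e \<in> ?A. z \<in> e}. \<omega> e / ?m z) \<le> 1" using full[OF z] by simp
    qed
    show "\<exists>z\<in>\<Omega>. (\<Sum>e\<in>{e \<in> ?A. z \<in> e}. \<omega> e / ?m z) < 1"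
    proof
      have "(\<Sum>e\<in>{e \<in> ?A. a \<in> e}. \<omega> e / ?m a) < (\<Sum>e\<in>{e \<in> E. a \<in> e}. \<omega> e / ?m a)"
      proof (rule sum_strict_mono2)
        show "{a, b} \<in> {e \<in> E. a \<in> e} - {e \<in> ?A. a \<in> e}"
          using ab by (auto simp: adj_def induced_edges_def)
        show "\<omega> {a, b} / ?m a > 0"
          using pos ab m_pos by (simp add: positive_weights_def adj_def)
      qed (use A finite_E nonneg[OF ab(1)] in auto)
      then show "(\<Sum>e\<in>{e \<in> ?A. a \<in> e}. \<omega> e / ?m a) < 1" using full[OF ab(1)] by simp
    qed (rule ab(1))
  qed
  finally show ?thesis by simp
qed

section \<open>The density condition makes the energy coercive\<close>

text \<open>With \<open>exp (s x)\<close> standing for \<open>1 / m x\<close>, and \<open>\<theta> > 0\<close>, the critical points of this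
  convex function are the balanced weights, up to a common factor, in logarithmic coordinates.\<close>

definition energy :: "real \<Rightarrow> ('a \<Rightarrow> real) \<Rightarrow> real" where
  "energy \<theta> s = \<theta> * (\<Sum>e\<in>E. ln (\<Sum>z\<in>e. exp (s z))) - sum s V"

text \<open>The tropical version of the energy: up to a bounded error it agrees with the energy, and it is
  linear as long as the order of the values of \<open>s\<close> does not change.\<close>

definition max_energy :: "real \<Rightarrow> ('a \<Rightarrow> real) \<Rightarrow> real" where
  "max_energy \<theta> s = \<theta> * (\<Sum>e\<in>E. Max (s ` e)) - sum s V"

lemma max_energy_le_energy:
  assumes "\<theta> \<ge> 0"
  shows "max_energy \<theta> s \<le> energy \<theta> s"
proof -
  have "Max (s ` e) \<le> ln (\<Sum>z\<in>e. exp (s z))" if "e \<in> E" for e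
  proof -
    have e: "finite e" "e \<noteq> {}" using that edge_finite edge_nonempty by blast+
    then have "Max (s ` e) \<in> s ` e" by simp
    then obtain w where w: "w \<in> e" "Max (s ` e) = s w" by blast
    have "exp (s w) \<le> (\<Sum>z\<in>e. exp (s z))"
      using w e by (intro member_le_sum) auto
    then show ?thesis
      using w ln_le_cancel_iff[of "exp (s w)" "\<Sum>z\<in>e. exp (s z)"]
      by (smt (verit) exp_gt_zero ln_exp)
  qed
  then show ?thesis
    using assms unfolding energy_def max_energy_def
    by (intro diff_right_mono mult_left_mono sum_mono) auto
qed

text \<open>Raise the lowest level set \<open>B\<close> by at most the gap to the next value. The maximum over an edge
  changes only if both endpoints lie in \<open>B\<close>, because otherwise an endpoint outside \<open>B\<close> already
  attains it before and after.\<close>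

lemma max_energy_raise:
  fixes d m \<theta> :: real
  assumes "B \<subseteq> V" and B: "\<And>z. z \<in> B \<Longrightarrow> s z = m" and "d \<ge> 0"
    and rest: "\<And>z. z \<in> V - B \<Longrightarrow> m + d \<le> s z"
  shows "max_energy \<theta> (\<lambda>z. if z \<in> B then s z + d else s z) =
    max_energy \<theta> s - d * (card B - \<theta> * card (induced_edges E B))"
proof -
  let ?s = "\<lambda>z. if z \<in> B then s z + d else s z"
  have "Max (?s ` e) = Max (s ` e) + (if e \<subseteq> B then d else 0)" if e: "e \<in> E" for e
  proof -
    note fe = edge_finite[OF e] edge_nonempty[OF e]
    show ?thesis
    proof (cases "e \<subseteq> B")
      case True
      then have "s ` e = {m}" "?s ` e = {m + d}" using B fe by force+
      then show ?thesis using True by simp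
    next
      case False
      then obtain w where w: "w \<in> e" "w \<notin> B" by blast
      have "?s z \<le> Max (s ` e)" if "z \<in> e" for z
      proof (cases "z \<in> B")
        case True
        have "m + d \<le> s w" using rest w edge_subset[OF e] by blast
        also have "s w \<le> Max (s ` e)" using w fe by simp
        finally show ?thesis using True B by simp
      qed (use that fe in simp)
      moreover have "s z \<le> Max (?s ` e)" if "z \<in> e" for z
      proof -
        have "s z \<le> ?s z" using \<open>d \<ge> 0\<close> by simp
        also have "?s z \<le> Max (?s ` e)" by (rule Max_ge) (use that fe in auto)
        finally show ?thesis .
      qed
      ultimately have "Max (?s ` e) = Max (s ` e)"
        using fe by (intro antisym Max.boundedI ballI) (blast | simp)+
      then show ?thesis using False by simp
    qed
  qed
  then have "(\<Sum>e\<in>E. Max (?s ` e)) = (\<Sum>e\<in>E. Max (s ` e)) + (\<Sum>e\<in>E. if e \<subseteq> B then d else 0)"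
    by (simp add: sum.distrib)
  also have "(\<Sum>e\<in>E. if e \<subseteq> B then d else 0) = card (induced_edges E B) * d"
    using finite_E by (simp add: induced_edges_def flip: sum.inter_filter)
  finally have edges: "(\<Sum>e\<in>E. Max (?s ` e)) = (\<Sum>e\<in>E. Max (s ` e)) + card (induced_edges E B) * d" .
  have "sum ?s V = (\<Sum>z\<in>V. s z + (if z \<in> B then d else 0))"
    by (intro sum.cong) auto
  also have "\<dots> = sum s V + card B * d"
    using finite_V \<open>B \<subseteq> V\<close> by (simp add: sum.distrib Int_absorb1 flip: sum.inter_restrict)
  finally show ?thesis
    unfolding max_energy_def edges by (simp add: algebra_simps)
qed

text \<open>Induction on the number of distinct values of \<open>s\<close>: raising the lowest value to the second
  lowest merges two level sets, decreases the oscillation by at most the gap \<open>d\<close> and the energy by at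
  least \<open>c d\<close>. A constant \<open>s\<close> has energy zero, by the choice of \<open>\<theta>\<close>.\<close>

lemma max_energy_ge_oscillation:
  fixes c \<theta> :: real
  assumes bal: "\<theta> * card E = card V" and "c \<ge> 0"
    and c: "\<And>\<Omega>. \<Omega> \<noteq> {} \<Longrightarrow> \<Omega> \<subset> V \<Longrightarrow> c \<le> card \<Omega> - \<theta> * card (induced_edges E \<Omega>)"
    and uv: "u \<in> V" "v \<in> V"
  shows "c * (s u - s v) \<le> max_energy \<theta> s"
proof (induction "card (s ` V)" arbitrary: s rule: less_induct)
  case less
  define m where "m = Min (s ` V)"
  define B where "B = {z \<in> V. s z = m}"
  have m_le: "m \<le> s z" if "z \<in> V" for z
    using that finite_V by (simp add: m_def)
  have "m \<in> s ` V" unfolding m_def using finite_V V_nonempty by simp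
  then have "B \<noteq> {}" by (auto simp: B_def)
  show ?case
  proof (cases "B = V")
    case True
    then have const: "s z = m" if "z \<in> V" for z using that by (auto simp: B_def)
    have "s ` e = {m}" if "e \<in> E" for e
      using that const edge_subset edge_nonempty by fast
    then have "max_energy \<theta> s = 0"
      using bal const by (simp add: max_energy_def algebra_simps)
    then show ?thesis using const uv by simp
  next
    case False
    then have "V - B \<noteq> {}" "B \<subset> V" by (auto simp: B_def)
    define d where "d = Min (s ` (V - B)) - m"
    have rest: "m + d \<le> s z" if "z \<in> V - B" for z
      using that finite_V by (simp add: d_def)
    have "Min (s ` (V - B)) \<in> s ` (V - B)"
      using finite_V \<open>V - B \<noteq> {}\<close> by (intro Min_in) auto
    then obtain w where w: "w \<in> V - B" "s w = m + d" by (auto simp: d_def)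
    then have "d > 0" using m_le[of w] by (force simp: B_def)
    define t where "t z = (if z \<in> B then s z + d else s z)" for z
    have "t z \<in> s ` V - {m}" if "z \<in> V" for z
    proof (cases "z \<in> B")
      case True
      then have "t z = s w" using w by (simp add: t_def B_def)
      then show ?thesis using w \<open>d > 0\<close>
        by (metis Diff_iff empty_iff imageI insert_iff less_add_same_cancel1 less_irrefl)
    next
      case False
      then show ?thesis using that by (simp add: t_def B_def)
    qed
    then have "t ` V \<subseteq> s ` V - {m}" by blast
    then have "card (t ` V) < card (s ` V)"
      using finite_V \<open>m \<in> s ` V\<close> by (intro psubset_card_mono) auto
    then have "c * (t u - t v) \<le> max_energy \<theta> t" by (rule less)
    moreover have "max_energy \<theta> t = max_energy \<theta> s - d * (card B - \<theta> * card (induced_edges E B))"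
      unfolding t_def using \<open>d > 0\<close> rest
      by (intro max_energy_raise[where m = m]) (auto simp: B_def)
    moreover have "d * c \<le> d * (card B - \<theta> * card (induced_edges E B))"
      using \<open>d > 0\<close> c[OF \<open>B \<noteq> {}\<close> \<open>B \<subset> V\<close>] by simp
    moreover have "c * (s u - s v) \<le> c * (t u - t v + d)"
      using \<open>c \<ge> 0\<close> \<open>d > 0\<close> by (intro mult_left_mono) (auto simp: t_def)
    ultimately show ?thesis by (simp add: algebra_simps)
  qed
qed

section \<open>Minimising the energy\<close>

lemma continuous_on_energy: "continuous_on A (energy \<theta>)"
proof -
  have "(\<Sum>z\<in>e. exp (s z)) \<noteq> 0" if "e \<in> E" for e and s :: "'a \<Rightarrow> real"
    using that edge_finite edge_nonempty by (intro less_imp_neq[symmetric] sum_pos) auto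
  then show ?thesis
    unfolding energy_def[abs_def]
    by (intro continuous_intros continuous_on_product_coordinates[THEN continuous_on_subset]) auto
qed

lemma energy_cong: "(\<And>z. z \<in> V \<Longrightarrow> s z = t z) \<Longrightarrow> energy \<theta> s = energy \<theta> t"
  using edge_subset unfolding energy_def
  by (intro arg_cong2[of _ _ _ _ "(-)"] arg_cong[of _ _ "(*) \<theta>"] sum.cong arg_cong[of _ _ ln]) auto

lemma energy_shift:
  fixes \<theta> :: real
  assumes bal: "\<theta> * card E = card V"
  shows "energy \<theta> (\<lambda>z. s z + k) = energy \<theta> s"
proof -
  have "ln (\<Sum>z\<in>e. exp (s z + k)) = ln (\<Sum>z\<in>e. exp (s z)) + k" if "e \<in> E" for e
  proof -
    have "(\<Sum>z\<in>e. exp (s z)) > 0"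
      using that edge_finite edge_nonempty by (intro sum_pos) auto
    then show ?thesis
      by (simp add: exp_add ln_mult flip: sum_distrib_right)
  qed
  then have "energy \<theta> (\<lambda>z. s z + k) = energy \<theta> s + k * (\<theta> * card E - card V)"
    by (simp add: energy_def sum.distrib algebra_simps)
  then show ?thesis using bal by simp
qed

text \<open>Values outside \<open>V\<close> are irrelevant for the energy; pinning them to zero makes the box
  compact in the product topology on all functions.\<close>

lemma compact_box:
  fixes D :: real
  shows "compact {s :: 'a \<Rightarrow> real. \<forall>z. s z \<in> (if z \<in> V then {0..D} else {0})}" (is "compact ?K")
proof -
  have "?K = PiE UNIV (\<lambda>z. if z \<in> V then {0..D} else {0})" unfolding PiE_UNIV_domain Pi_def by blast
  then have "compactin (product_topology (\<lambda>_. euclidean) UNIV) ?K"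
    by (simp add: compactin_PiE)
  then show ?thesis by (simp add: euclidean_product_topology)
qed

text \<open>By coercivity and shift invariance it is enough to minimise over a box of side \<open>D + 2\<close>,
  where \<open>D\<close> bounds the oscillation of any \<open>s\<close> with energy at most that of zero. A minimiser has
  oscillation at most \<open>D\<close>, so it can be shifted to have smallest value 1 and then lies at distance at
  least 1 from the boundary of the box.\<close>

lemma energy_coordinatewise_minimum:
  fixes \<theta> :: real
  assumes bal: "\<theta> * card E = card V"
    and sparse: "\<And>\<Omega>. \<Omega> \<noteq> {} \<Longrightarrow> \<Omega> \<subset> V \<Longrightarrow> \<theta> * card (induced_edges E \<Omega>) < card \<Omega>"
  obtains s where "\<And>x t. x \<in> V \<Longrightarrow> \<bar>s x - t\<bar> < 1 \<Longrightarrow> energy \<theta> s \<le> energy \<theta> (s(x := t))"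
proof -
  let ?gap = "\<lambda>\<Omega>. real (card \<Omega>) - \<theta> * card (induced_edges E \<Omega>)"
  let ?S = "{\<Omega>. \<Omega> \<noteq> {} \<and> \<Omega> \<subset> V}"
  have "finite ?S" using finite_V by (auto intro: finite_subset[of _ "Pow V"])
  \<comment> \<open>Any positive lower bound of the gaps serves, so 1 may be inserted to make the set visibly nonempty.\<close>
  define c where "c = Min (insert 1 (?gap ` ?S))"
  have "c > 0" using \<open>finite ?S\<close> sparse by (auto simp: c_def)
  have c: "c \<le> ?gap \<Omega>" if "\<Omega> \<noteq> {}" "\<Omega> \<subset> V" for \<Omega>
    unfolding c_def using that \<open>finite ?S\<close> by (intro Min_le) auto
  have "\<theta> \<ge> 0"
  proof -
    have "\<theta> * card E \<ge> 0" using bal by simp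
    then show ?thesis using card_E_pos by (simp add: zero_le_mult_iff)
  qed
  define D where "D = energy \<theta> (\<lambda>_. 0) / c"
  have osc: "s u - s v \<le> D" if "energy \<theta> s \<le> energy \<theta> (\<lambda>_. 0)" "u \<in> V" "v \<in> V" for s u v
  proof -
    have "c * (s u - s v) \<le> max_energy \<theta> s"
      using max_energy_ge_oscillation[OF bal _ c] \<open>c > 0\<close> that by simp
    also have "\<dots> \<le> energy \<theta> s" by (rule max_energy_le_energy[OF \<open>\<theta> \<ge> 0\<close>])
    also have "\<dots> \<le> energy \<theta> (\<lambda>_. 0)" by fact
    finally show ?thesis using \<open>c > 0\<close> by (simp add: D_def field_simps)
  qed
  have "D \<ge> 0" using osc[of "\<lambda>_. 0"] V_nonempty by auto
  define K :: "('a \<Rightarrow> real) set"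
    where "K = {s. \<forall>z. s z \<in> (if z \<in> V then {0..D + 2} else {0})}"
  have zero: "(\<lambda>_. 0) \<in> K" using \<open>D \<ge> 0\<close> by (simp add: K_def)
  have "compact K" unfolding K_def by (rule compact_box)
  then obtain r where r: "r \<in> K" "\<And>s. s \<in> K \<Longrightarrow> energy \<theta> r \<le> energy \<theta> s"
    using continuous_attains_inf[of K "energy \<theta>"] continuous_on_energy zero
    by (metis empty_iff)
  define m where "m = Min (r ` V)"
  have "m \<in> r ` V" unfolding m_def using finite_V V_nonempty by simp
  have r_bounds: "m \<le> r z" "r z \<le> m + D" if "z \<in> V" for z
  proof -
    show "m \<le> r z" using that finite_V by (simp add: m_def)
    obtain w where "w \<in> V" "m = r w" using \<open>m \<in> r ` V\<close> by blast
    then show "r z \<le> m + D" using osc[OF r(2)[OF zero] that] by fastforce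
  qed
  define s where "s z = (if z \<in> V then r z + (1 - m) else 0)" for z
  have "energy \<theta> s = energy \<theta> (\<lambda>z. r z + (1 - m))"
    by (rule energy_cong) (simp add: s_def)
  then have energy_s: "energy \<theta> s = energy \<theta> r" using energy_shift[OF bal] by simp
  show thesis
  proof
    fix x t assume x: "x \<in> V" "\<bar>s x - t\<bar> < 1"
    have "(s(x := t)) z \<in> (if z \<in> V then {0..D + 2} else {0})" for z
      using r_bounds[of z] r_bounds[of x] x by (auto simp: s_def)
    then have "s(x := t) \<in> K" by (simp only: K_def mem_Collect_eq) blast
    then show "energy \<theta> s \<le> energy \<theta> (s(x := t))" using r(2) energy_s by simp
  qed
qed

lemma energy_has_partial_derivative:
  assumes "x \<in> V"
  shows "((\<lambda>t. energy \<theta> (s(x := t))) has_real_derivative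
    \<theta> * (\<Sum>e\<in>{e \<in> E. x \<in> e}. exp (s x) / (\<Sum>z\<in>e. exp (s z))) - 1) (at (s x))"
proof -
  have coord: "((\<lambda>t. (s(x := t)) z) has_real_derivative (if z = x then 1 else 0)) (at (s x))" for z
    by (cases "z = x") auto
  have exps: "((\<lambda>t. \<Sum>z\<in>e. exp ((s(x := t)) z)) has_real_derivative
      (if x \<in> e then exp (s x) else 0)) (at (s x))" if "e \<in> E" for e
  proof -
    have "((\<lambda>t. \<Sum>z\<in>e. exp ((s(x := t)) z)) has_real_derivative
      (\<Sum>z\<in>e. exp ((s(x := s x)) z) * (if z = x then 1 else 0))) (at (s x))"
      by (intro DERIV_sum DERIV_fun_exp coord)
    also have "(\<Sum>z\<in>e. exp ((s(x := s x)) z) * (if z = x then 1 else 0))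
        = (\<Sum>z\<in>e. if z = x then exp (s z) else 0)"
      by (intro sum.cong) auto
    also have "\<dots> = (if x \<in> e then exp (s x) else 0)"
      using edge_finite[OF that] by (simp add: sum.delta)
    finally show ?thesis .
  qed
  have logs: "((\<lambda>t. ln (\<Sum>z\<in>e. exp ((s(x := t)) z))) has_real_derivative
      (if x \<in> e then exp (s x) / (\<Sum>z\<in>e. exp (s z)) else 0)) (at (s x))" if "e \<in> E" for e
  proof -
    have "(\<Sum>z\<in>e. exp ((s(x := s x)) z)) > 0"
      using that edge_finite edge_nonempty by (intro sum_pos) auto
    from DERIV_chain2[where f = ln and g = "\<lambda>t. \<Sum>z\<in>e. exp ((s(x := t)) z)",
        OF DERIV_ln_divide[OF this] exps[OF that]]
    show ?thesis by (rule DERIV_cong) simp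
  qed
  have "((\<lambda>t. energy \<theta> (s(x := t))) has_real_derivative
      \<theta> * (\<Sum>e\<in>E. if x \<in> e then exp (s x) / (\<Sum>z\<in>e. exp (s z)) else 0)
        - (\<Sum>z\<in>V. if z = x then 1 else 0)) (at (s x))"
    unfolding energy_def by (intro DERIV_diff DERIV_cmult DERIV_sum logs coord)
  then show ?thesis
    using assms finite_V finite_E by (simp add: sum.delta sum.inter_filter)
qed

text \<open>At the minimiser the partial derivative at \<open>x\<close> vanishes, which says that the weights
  \<open>\<theta> / (exp (s x) + exp (s y))\<close> have degree \<open>exp (- s x)\<close> at \<open>x\<close>; the balance equation is
  then immediate.\<close>

lemma sparse_imp_balanced:
  fixes \<theta> :: real
  assumes bal: "\<theta> * card E = card V"
    and sparse: "\<And>\<Omega>. \<Omega> \<noteq> {} \<Longrightarrow> \<Omega> \<subset> V \<Longrightarrow> \<theta> * card (induced_edges E \<Omega>) < card \<Omega>"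
  obtains \<omega> where "positive_weights E \<omega>" "balanced \<theta> \<omega>"
proof -
  obtain s where s: "\<And>x t. x \<in> V \<Longrightarrow> \<bar>s x - t\<bar> < 1 \<Longrightarrow> energy \<theta> s \<le> energy \<theta> (s(x := t))"
    using energy_coordinatewise_minimum[OF bal sparse] by blast
  define \<omega> where "\<omega> e = \<theta> / (\<Sum>z\<in>e. exp (s z))" for e
  have Z_pos: "(\<Sum>z\<in>e. exp (s z)) > 0" if "e \<in> E" for e
    using that edge_finite edge_nonempty by (intro sum_pos) auto
  have "\<theta> > 0"
  proof -
    have "\<theta> * card E > 0" using bal card_V_pos by simp
    then show ?thesis using card_E_pos by (simp add: zero_less_mult_iff)
  qed
  have degree: "weighted_degree V E \<omega> x = exp (- s x)" if "x \<in> V" for x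
  proof -
    have "\<theta> * (\<Sum>e\<in>{e \<in> E. x \<in> e}. exp (s x) / (\<Sum>z\<in>e. exp (s z))) - 1 = 0"
      using energy_has_partial_derivative[OF that] zero_less_one
      by (rule DERIV_local_min) (use s that in simp)
    then have "exp (s x) * weighted_degree V E \<omega> x = 1"
      by (simp add: weighted_degree_incident \<omega>_def sum_distrib_left mult.commute)
    then show ?thesis by (simp add: exp_minus field_simps)
  qed
  show thesis
  proof
    show "positive_weights E \<omega>"
      using \<open>\<theta> > 0\<close> Z_pos by (simp add: positive_weights_def \<omega>_def)
    have "\<omega> {x, y} * (1 / weighted_degree V E \<omega> x + 1 / weighted_degree V E \<omega> y) = \<theta>"
      if xy: "adj E x y" for x y
    proof -
      have "(\<Sum>z\<in>{x, y}. exp (s z)) = exp (s x) + exp (s y)" using adj_distinct[OF xy] by simp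
      then show ?thesis
        using adj_in_V[OF xy] Z_pos[of "{x, y}"] xy
        by (simp add: degree \<omega>_def exp_minus adj_def inverse_eq_divide)
    qed
    then show "balanced \<theta> \<omega>" by (simp add: balanced_def)
  qed
qed

lemma sparse_iff_max_density:
  "(\<forall>\<Omega>. \<Omega> \<noteq> {} \<longrightarrow> \<Omega> \<subset> V \<longrightarrow> card V / card E * card (induced_edges E \<Omega>) < card \<Omega>) \<longleftrightarrow>
   Max ((\<lambda>\<Omega>. real (card (induced_edges E \<Omega>)) / real (card \<Omega>)) ` {\<Omega>. \<Omega> \<noteq> {} \<and> \<Omega> \<subset> V})
     < real (card E) / real (card V)"
proof -
  let ?S = "{\<Omega>. \<Omega> \<noteq> {} \<and> \<Omega> \<subset> V}"
  have "finite ?S" using finite_V by (auto intro: finite_subset[of _ "Pow V"])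
  moreover have "?S \<noteq> {}" using V_nonempty singleton_psubset by blast
  moreover have "card (induced_edges E \<Omega>) / card \<Omega> < card E / card V \<longleftrightarrow>
      card V / card E * card (induced_edges E \<Omega>) < card \<Omega>" if "\<Omega> \<in> ?S" for \<Omega>
  proof -
    have "card \<Omega> > 0" using that finite_V finite_subset by (force simp: card_gt_0_iff)
    then show ?thesis using card_V_pos card_E_pos by (simp add: field_simps)
  qed
  ultimately show ?thesis by (subst Max_less_iff) auto
qed

end

section \<open>Weights of constant curvature\<close>

theorem theorem3p1:
  fixes V :: "'a set" and E :: "'a set set"
  assumes "simple_graph V E"
    and "connected_graph V E"
    and "E \<noteq> {}"
    and "girth E \<ge> 6"
  shows "(\<exists>\<omega> :: 'a set \<Rightarrow> real. positive_weights E \<omega> \<and>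
            (\<forall>x y. {x, y} \<in> E \<longrightarrow>
               lly_curvature V E \<omega> x y = 2 * (real (card V) / real (card E) - 1)))
         \<longleftrightarrow>
         Max ((\<lambda>\<Omega>. real (card (induced_edges E \<Omega>)) / real (card \<Omega>)) ` {\<Omega>. \<Omega> \<noteq> {} \<and> \<Omega> \<subset> V})
           < real (card E) / real (card V)"
proof -
  interpret girth_six_graph V E by unfold_locales fact+
  let ?\<theta> = "real (card V) / real (card E)"
  have "(\<exists>\<omega>. positive_weights E \<omega> \<and>
          (\<forall>x y. {x, y} \<in> E \<longrightarrow> lly_curvature V E \<omega> x y = 2 * (?\<theta> - 1)))
      \<longleftrightarrow> (\<exists>\<omega>. positive_weights E \<omega> \<and> balanced ?\<theta> \<omega>)"
  proof -
    have "(\<forall>x y. {x, y} \<in> E \<longrightarrow> lly_curvature V E \<omega> x y = 2 * (?\<theta> - 1)) \<longleftrightarrow> balanced ?\<theta> \<omega>"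
      if "positive_weights E \<omega>" for \<omega>
    proof -
      have "lly_curvature V E \<omega> x y = 2 * (?\<theta> - 1) \<longleftrightarrow>
          \<omega> {x, y} * (1 / weighted_degree V E \<omega> x + 1 / weighted_degree V E \<omega> y) = ?\<theta>"
        if "adj E x y" for x y
      proof -
        have "2 * a - 2 = 2 * (b - 1) \<longleftrightarrow> a = b" for a b :: real by auto
        then show ?thesis
          unfolding lly_curvature_eq[OF \<open>positive_weights E \<omega>\<close> that] mult.assoc .
      qed
      then show ?thesis by (auto simp: balanced_def adj_def)
    qed
    then show ?thesis by blast
  qed
  also have "\<dots> \<longleftrightarrow> (\<forall>\<Omega>. \<Omega> \<noteq> {} \<longrightarrow> \<Omega> \<subset> V \<longrightarrow> ?\<theta> * card (induced_edges E \<Omega>) < card \<Omega>)"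
  proof
    assume "\<exists>\<omega>. positive_weights E \<omega> \<and> balanced ?\<theta> \<omega>"
    then show "\<forall>\<Omega>. \<Omega> \<noteq> {} \<longrightarrow> \<Omega> \<subset> V \<longrightarrow> ?\<theta> * card (induced_edges E \<Omega>) < card \<Omega>"
      using balanced_imp_sparse by blast
  next
    assume sparse: "\<forall>\<Omega>. \<Omega> \<noteq> {} \<longrightarrow> \<Omega> \<subset> V \<longrightarrow> ?\<theta> * card (induced_edges E \<Omega>) < card \<Omega>"
    have "?\<theta> * card E = card V" using card_E_pos by simp
    then show "\<exists>\<omega>. positive_weights E \<omega> \<and> balanced ?\<theta> \<omega>"
      using sparse_imp_balanced[of ?\<theta>] sparse by blast
  qed
  finally show ?thesis unfolding sparse_iff_max_density .
qed

end
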